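(* Consider a two-area power network and a market on it with $N$ independent interface bidders. Assume that (i) both the joint economic dispatch problem (JED) and the GCTS clearing problem are feasible and each has a unique optimum; (ii) the number of aggregated bids for each pair of source and sink buses grows unbounded with $N$; (iii) the bidding prices of all participants go to zero as $N\to\infty$, i.e. $\lim_{N\to\infty}\Delta\pi=0$. Then the tie-line power flows and the generations in each area scheduled by GCTS converge to those of JED as $N\to\infty$.
   Context: Network (DC power flow model). A connected network is partitioned into two areas $i=1,2$. A tie-line is a line joining the two areas. A boundary bus is a bus to which a tie-line is attached; the other buses are internal. Boundary buses carry no generation or load; each internal bus has one generator and one load. For area $i$: $g_i$ is the vector of generations, $d_i$ the vector of (fixed) loads, $\theta_i$ the vector of phase angles at internal buses, $\bar\theta_i$ the vector of phase angles at boundary buses, and $\bar\theta=(\bar\theta_1,\bar\theta_2)$. One boundary bus is the phase angle reference. The matrix $Y$ is the nodal matrix (weighted graph Laplacian) built from reciprocals of the branch reactances, with blocks $Y_{ii}$ (internal-internal), $Y_{i\bar i},Y_{\bar i i}$ (internal-boundary), $Y_{\bar i\bar i}$ (boundary-boundary in area $i$), $Y_{\bar1\bar2},Y_{\bar2\bar1}$ (between the boundaries of the two areas, coming from the tie-lines). Put $\tilde Y_{\bar i\bar i}=Y_{\bar i\bar i}-Y_{\bar i i}Y_{ii}^{-1}Y_{i\bar i}$. The flow on a line is the difference of its end angles divided by its reactance. Interface bids. A bid $k$ specifies an ordered pair of boundary buses (a source bus in one area, a sink bus in the other; they need not be joined by a tie-line): it buys (withdraws) at the source and sells (injects) the same amount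 at the sink. It has a price $\Delta\pi_k$ and a maximum quantity $s_{\max,k}$; $\Delta\pi$ and $s_{\max}$ are the vectors of these. The incidence matrix $M_i$ has one row per boundary bus of area $i$ and one column per bid; its entry is $1$ if the bid buys at that bus, $-1$ if it sells at that bus, and $0$ otherwise. The vector $s$ collects the cleared quantities of the bids. GCTS clearing problem: minimize $c_1(g_1)+c_2(g_2)+\Delta\pi^Ts$ over $g_1,g_2,s,\theta_1,\theta_2,\bar\theta$ subject to (a) $\check g_i\le g_i\le\hat g_i$, $i=1,2$; (b) $0\le s\le s_{\max}$; (c) internal line limits $H_i\theta_i+H_{\bar i}\bar\theta_i\le f_i$, $i=1,2$; (d) tie-line limits $\bar H_{\bar1}\bar\theta_1+\bar H_{\bar2}\bar\theta_2\le\bar f$; (e) power flow: $Y_{11}\theta_1+Y_{1\bar1}\bar\theta_1=g_1-d_1$, $\;Y_{\bar11}\theta_1+Y_{\bar1\bar1}\bar\theta_1+Y_{\bar1\bar2}\bar\theta_2=0$, $\;Y_{\bar2\bar1}\bar\theta_1+Y_{\bar2\bar2}\bar\theta_2+Y_{\bar22}\theta_2=0$, $\;Y_{2\bar2}\bar\theta_2+Y_{22}\theta_2=g_2-d_2$; (f) $\tilde Y_{\bar1\bar1}\bar\theta_1+Y_{\bar1\bar2}\bar\theta_2=M_1s$, $\;Y_{\bar2\bar1}\bar\theta_1+\tilde Y_{\bar2\bar2}\bar\theta_2=M_2s$. Here $c_i$ is the (convex) generation cost function of area $i$; $\check g_i,\hat g_i,f_i,\bar f$ are given limits; the rows of $H_i,H_{\bar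 i}$ (resp. $\bar H_{\bar1},\bar H_{\bar2}$) give internal line (resp. tie-line) flows. JED: minimize $c_1(g_1)+c_2(g_2)$ over $g_1,g_2,\theta_1,\theta_2,\bar\theta$ subject to (a), (c), (d), (e) only (no bids).
   Formalization: Assumption (ii) is taken to say that the total maximum quantity of the bids for each source-sink pair tends to infinity; with only the number of bids growing, the claim fails when the maximum quantities are summable. *)

theory Defs
  imports "HOL-Analysis.Analysis"
begin

text \<open>
  Buses are typed by their role: \<open>'i1\<close>, \<open>'i2\<close> index the internal buses and \<open>'b1\<close>, \<open>'b2\<close> the
  boundary buses of the two areas. That boundary buses are exactly the buses to which a tie-line
  is attached is required in \<open>dc_network\<close> below. Parallel lines are allowed.
\<close>

type_synonym ('i1, 'b1, 'i2, 'b2) bus = "('i1 + 'b1) + ('i2 + 'b2)"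

abbreviation int1 :: "'i1 \<Rightarrow> ('i1, 'b1, 'i2, 'b2) bus" where "int1 i \<equiv> Inl (Inl i)"
abbreviation bnd1 :: "'b1 \<Rightarrow> ('i1, 'b1, 'i2, 'b2) bus" where "bnd1 b \<equiv> Inl (Inr b)"
abbreviation int2 :: "'i2 \<Rightarrow> ('i1, 'b1, 'i2, 'b2) bus" where "int2 i \<equiv> Inr (Inl i)"
abbreviation bnd2 :: "'b2 \<Rightarrow> ('i1, 'b1, 'i2, 'b2) bus" where "bnd2 b \<equiv> Inr (Inr b)"

text \<open>
  The rows of the limit matrices \<open>H\<close> are arbitrary finite families of lines taken in one of their
  two directions: \<open>(l, True)\<close> stands for the flow on \<open>l\<close> in its reference direction and
  \<open>(l, False)\<close> for the flow in the opposite direction. So a line may be limited in one direction,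
  in both, or not at all.
\<close>

record ('i1::finite, 'b1::finite, 'i2::finite, 'b2::finite, 'l::finite, 'm1::finite, 'm2::finite, 'mt::finite) network =
  line_from :: "'l \<Rightarrow> ('i1, 'b1, 'i2, 'b2) bus"
  line_to :: "'l \<Rightarrow> ('i1, 'b1, 'i2, 'b2) bus"
  reactance :: "'l \<Rightarrow> real"
  ref_bus :: "'b1 + 'b2"
  load1 :: "real ^ 'i1"
  load2 :: "real ^ 'i2"
  gen_min1 :: "real ^ 'i1"
  gen_max1 :: "real ^ 'i1"
  gen_min2 :: "real ^ 'i2"
  gen_max2 :: "real ^ 'i2"
  cost1 :: "real ^ 'i1 \<Rightarrow> real"
  cost2 :: "real ^ 'i2 \<Rightarrow> real"
  row1 :: "'m1 \<Rightarrow> 'l \<times> bool"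
  row2 :: "'m2 \<Rightarrow> 'l \<times> bool"
  row_tie :: "'mt \<Rightarrow> 'l \<times> bool"
  limit1 :: "real ^ 'm1"
  limit2 :: "real ^ 'm2"
  limit_tie :: "real ^ 'mt"

definition line_ends ::
  "('i1::finite, 'b1::finite, 'i2::finite, 'b2::finite, 'l::finite, 'm1::finite, 'm2::finite, 'mt::finite) network
    \<Rightarrow> 'l \<Rightarrow> ('i1, 'b1, 'i2, 'b2) bus set" where
  "line_ends net l = {line_from net l, line_to net l}"

definition tie_lines ::
  "('i1::finite, 'b1::finite, 'i2::finite, 'b2::finite, 'l::finite, 'm1::finite, 'm2::finite, 'mt::finite) network
    \<Rightarrow> 'l set" where
  "tie_lines net = {l. isl (line_from net l) \<noteq> isl (line_to net l)}"

definition internal_lines1 ::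
  "('i1::finite, 'b1::finite, 'i2::finite, 'b2::finite, 'l::finite, 'm1::finite, 'm2::finite, 'mt::finite) network
    \<Rightarrow> 'l set" where
  "internal_lines1 net = {l. isl (line_from net l) \<and> isl (line_to net l)}"

definition internal_lines2 ::
  "('i1::finite, 'b1::finite, 'i2::finite, 'b2::finite, 'l::finite, 'm1::finite, 'm2::finite, 'mt::finite) network
    \<Rightarrow> 'l set" where
  "internal_lines2 net = {l. \<not> isl (line_from net l) \<and> \<not> isl (line_to net l)}"

definition connected_network ::
  "('i1::finite, 'b1::finite, 'i2::finite, 'b2::finite, 'l::finite, 'm1::finite, 'm2::finite, 'mt::finite) network
    \<Rightarrow> bool" where
  "connected_network net \<longleftrightarrow>
     (\<forall>u v. (u, v) \<in> {(x, y). \<exists>l. line_ends net l = {x, y}}\<^sup>*)"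

definition is_boundary :: "('i1, 'b1, 'i2, 'b2) bus \<Rightarrow> bool" where
  "is_boundary v \<longleftrightarrow> v \<in> range bnd1 \<union> range bnd2"

definition dc_network ::
  "('i1::finite, 'b1::finite, 'i2::finite, 'b2::finite, 'l::finite, 'm1::finite, 'm2::finite, 'mt::finite) network
    \<Rightarrow> bool" where
  "dc_network net \<longleftrightarrow>
     (\<forall>l. line_from net l \<noteq> line_to net l) \<and>
     (\<forall>l. reactance net l > 0) \<and>
     connected_network net \<and>
     (\<forall>v. is_boundary v \<longleftrightarrow> (\<exists>l \<in> tie_lines net. v \<in> line_ends net l)) \<and>
     fst ` range (row1 net) \<subseteq> internal_lines1 net \<and>
     fst ` range (row2 net) \<subseteq> internal_lines2 net \<and>
     fst ` range (row_tie net) \<subseteq> tie_lines net"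

definition nodal_matrix ::
  "('i1::finite, 'b1::finite, 'i2::finite, 'b2::finite, 'l::finite, 'm1::finite, 'm2::finite, 'mt::finite) network
    \<Rightarrow> real ^ ('i1, 'b1, 'i2, 'b2) bus ^ ('i1, 'b1, 'i2, 'b2) bus" where
  "nodal_matrix net =
     (\<chi> u v. if u = v then \<Sum>l | u \<in> line_ends net l. 1 / reactance net l
             else - (\<Sum>l | line_ends net l = {u, v}. 1 / reactance net l))"

definition block :: "('a::finite \<Rightarrow> 'n::finite) \<Rightarrow> ('b::finite \<Rightarrow> 'n) \<Rightarrow> real ^ 'n ^ 'n \<Rightarrow> real ^ 'b ^ 'a" where
  "block p q A = (\<chi> i j. A $ p i $ q j)"

definition reduced_block :: "('b::finite \<Rightarrow> 'n::finite) \<Rightarrow> ('i::finite \<Rightarrow> 'n) \<Rightarrow> real ^ 'n ^ 'n \<Rightarrow> real ^ 'b ^ 'b" where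
  "reduced_block b i A =
     block b b A - block b i A ** matrix_inv (block i i A) ** block i b A"

definition flow_coeff ::
  "('i1::finite, 'b1::finite, 'i2::finite, 'b2::finite, 'l::finite, 'm1::finite, 'm2::finite, 'mt::finite) network
    \<Rightarrow> 'l \<times> bool \<Rightarrow> ('i1, 'b1, 'i2, 'b2) bus \<Rightarrow> real" where
  "flow_coeff net r v =
     (if snd r then 1 else - 1) *
     (of_bool (v = line_from net (fst r)) - of_bool (v = line_to net (fst r))) / reactance net (fst r)"

definition limit_matrix ::
  "('i1::finite, 'b1::finite, 'i2::finite, 'b2::finite, 'l::finite, 'm1::finite, 'm2::finite, 'mt::finite) network
    \<Rightarrow> ('m::finite \<Rightarrow> 'l \<times> bool)
    \<Rightarrow> ('a::finite \<Rightarrow> ('i1, 'b1, 'i2, 'b2) bus) \<Rightarrow> real ^ 'a ^ 'm" where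
  "limit_matrix net rs p = (\<chi> m j. flow_coeff net (rs m) (p j))"

record ('i1, 'b1, 'i2, 'b2) dispatch =
  gen1 :: "real ^ 'i1"
  gen2 :: "real ^ 'i2"
  ang1 :: "real ^ 'i1"
  ang2 :: "real ^ 'i2"
  bang1 :: "real ^ 'b1"
  bang2 :: "real ^ 'b2"

fun bus_angle :: "('i1::finite, 'b1::finite, 'i2::finite, 'b2::finite) dispatch
    \<Rightarrow> ('i1, 'b1, 'i2, 'b2) bus \<Rightarrow> real" where
  "bus_angle x (Inl (Inl i)) = ang1 x $ i"
| "bus_angle x (Inl (Inr b)) = bang1 x $ b"
| "bus_angle x (Inr (Inl i)) = ang2 x $ i"
| "bus_angle x (Inr (Inr b)) = bang2 x $ b"

definition line_flow ::
  "('i1::finite, 'b1::finite, 'i2::finite, 'b2::finite, 'l::finite, 'm1::finite, 'm2::finite, 'mt::finite) network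
    \<Rightarrow> ('i1, 'b1, 'i2, 'b2) dispatch \<Rightarrow> 'l \<Rightarrow> real" where
  "line_flow net x l =
     (bus_angle x (line_from net l) - bus_angle x (line_to net l)) / reactance net l"

definition gen_limits ::
  "('i1::finite, 'b1::finite, 'i2::finite, 'b2::finite, 'l::finite, 'm1::finite, 'm2::finite, 'mt::finite) network
    \<Rightarrow> ('i1, 'b1, 'i2, 'b2) dispatch \<Rightarrow> bool" where
  "gen_limits net x \<longleftrightarrow>
     gen_min1 net \<le> gen1 x \<and> gen1 x \<le> gen_max1 net \<and>
     gen_min2 net \<le> gen2 x \<and> gen2 x \<le> gen_max2 net"

definition line_limits ::
  "('i1::finite, 'b1::finite, 'i2::finite, 'b2::finite, 'l::finite, 'm1::finite, 'm2::finite, 'mt::finite) network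
    \<Rightarrow> ('i1, 'b1, 'i2, 'b2) dispatch \<Rightarrow> bool" where
  "line_limits net x \<longleftrightarrow>
     limit_matrix net (row1 net) int1 *v ang1 x + limit_matrix net (row1 net) bnd1 *v bang1 x \<le> limit1 net \<and>
     limit_matrix net (row2 net) int2 *v ang2 x + limit_matrix net (row2 net) bnd2 *v bang2 x \<le> limit2 net \<and>
     limit_matrix net (row_tie net) bnd1 *v bang1 x + limit_matrix net (row_tie net) bnd2 *v bang2 x
       \<le> limit_tie net"

definition power_flow ::
  "('i1::finite, 'b1::finite, 'i2::finite, 'b2::finite, 'l::finite, 'm1::finite, 'm2::finite, 'mt::finite) network
    \<Rightarrow> ('i1, 'b1, 'i2, 'b2) dispatch \<Rightarrow> bool" where
  "power_flow net x \<longleftrightarrow>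
     (let Y = nodal_matrix net in
       block int1 int1 Y *v ang1 x + block int1 bnd1 Y *v bang1 x = gen1 x - load1 net \<and>
       block bnd1 int1 Y *v ang1 x + block bnd1 bnd1 Y *v bang1 x + block bnd1 bnd2 Y *v bang2 x = 0 \<and>
       block bnd2 bnd1 Y *v bang1 x + block bnd2 bnd2 Y *v bang2 x + block bnd2 int2 Y *v ang2 x = 0 \<and>
       block int2 bnd2 Y *v bang2 x + block int2 int2 Y *v ang2 x = gen2 x - load2 net)"

definition angle_reference ::
  "('i1::finite, 'b1::finite, 'i2::finite, 'b2::finite, 'l::finite, 'm1::finite, 'm2::finite, 'mt::finite) network
    \<Rightarrow> ('i1, 'b1, 'i2, 'b2) dispatch \<Rightarrow> bool" where
  "angle_reference net x \<longleftrightarrow>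
     (case ref_bus net of Inl b \<Rightarrow> bang1 x $ b = 0 | Inr b \<Rightarrow> bang2 x $ b = 0)"

definition jed_feasible ::
  "('i1::finite, 'b1::finite, 'i2::finite, 'b2::finite, 'l::finite, 'm1::finite, 'm2::finite, 'mt::finite) network
    \<Rightarrow> ('i1, 'b1, 'i2, 'b2) dispatch \<Rightarrow> bool" where
  "jed_feasible net x \<longleftrightarrow>
     gen_limits net x \<and> line_limits net x \<and> power_flow net x \<and> angle_reference net x"

definition jed_cost ::
  "('i1::finite, 'b1::finite, 'i2::finite, 'b2::finite, 'l::finite, 'm1::finite, 'm2::finite, 'mt::finite) network
    \<Rightarrow> ('i1, 'b1, 'i2, 'b2) dispatch \<Rightarrow> real" where
  "jed_cost net x = cost1 net (gen1 x) + cost2 net (gen2 x)"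

text \<open>
  Source and sink are boundary buses, with \<open>Inl\<close> for area 1 and \<open>Inr\<close> for area 2. A bidder may
  own several bids.
\<close>

record ('b1, 'b2) bid =
  bidder :: nat
  source :: "'b1 + 'b2"
  sink :: "'b1 + 'b2"
  price :: real
  max_qty :: real

definition valid_bid :: "nat \<Rightarrow> ('b1, 'b2) bid \<Rightarrow> bool" where
  "valid_bid N k \<longleftrightarrow> bidder k < N \<and> isl (source k) \<noteq> isl (sink k)"

definition incidence :: "('b1, 'b2) bid \<Rightarrow> 'b1 + 'b2 \<Rightarrow> real" where
  "incidence k b = (if b = source k then 1 else if b = sink k then - 1 else 0)"

text \<open>The products \<open>M\<^sub>1 s\<close> and \<open>M\<^sub>2 s\<close>; the vector \<open>s\<close> is a list parallel to the list of bids.\<close>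

definition bid_injection1 :: "('b1::finite, 'b2) bid list \<Rightarrow> real list \<Rightarrow> real ^ 'b1" where
  "bid_injection1 bids s = (\<chi> b. \<Sum>k<length bids. incidence (bids ! k) (Inl b) * s ! k)"

definition bid_injection2 :: "('b1, 'b2::finite) bid list \<Rightarrow> real list \<Rightarrow> real ^ 'b2" where
  "bid_injection2 bids s = (\<chi> b. \<Sum>k<length bids. incidence (bids ! k) (Inr b) * s ! k)"

definition gcts_feasible ::
  "('i1::finite, 'b1::finite, 'i2::finite, 'b2::finite, 'l::finite, 'm1::finite, 'm2::finite, 'mt::finite) network
    \<Rightarrow> ('b1, 'b2) bid list \<Rightarrow> ('i1, 'b1, 'i2, 'b2) dispatch \<times> real list \<Rightarrow> bool" where
  "gcts_feasible net bids = (\<lambda>(x, s).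
     gen_limits net x \<and>
     length s = length bids \<and> (\<forall>k<length bids. 0 \<le> s ! k \<and> s ! k \<le> max_qty (bids ! k)) \<and>
     line_limits net x \<and> power_flow net x \<and> angle_reference net x \<and>
     (let Y = nodal_matrix net in
       reduced_block bnd1 int1 Y *v bang1 x + block bnd1 bnd2 Y *v bang2 x = bid_injection1 bids s \<and>
       block bnd2 bnd1 Y *v bang1 x + reduced_block bnd2 int2 Y *v bang2 x = bid_injection2 bids s))"

definition gcts_cost ::
  "('i1::finite, 'b1::finite, 'i2::finite, 'b2::finite, 'l::finite, 'm1::finite, 'm2::finite, 'mt::finite) network
    \<Rightarrow> ('b1, 'b2) bid list \<Rightarrow> ('i1, 'b1, 'i2, 'b2) dispatch \<times> real list \<Rightarrow> real" where
  "gcts_cost net bids = (\<lambda>(x, s).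
     cost1 net (gen1 x) + cost2 net (gen2 x) + (\<Sum>k<length bids. price (bids ! k) * s ! k))"

definition pair_bids :: "('b1, 'b2) bid list \<Rightarrow> 'b1 + 'b2 \<Rightarrow> 'b1 + 'b2 \<Rightarrow> ('b1, 'b2) bid list" where
  "pair_bids bids p q = filter (\<lambda>k. source k = p \<and> sink k = q) bids"

text \<open>
  The amount of aggregated bids for a source-sink pair is measured by their total maximum quantity:
  a growing number of bids with, say, summable maximum quantities would not relax the interface.
\<close>

definition aggregated_quantity :: "('b1, 'b2) bid list \<Rightarrow> 'b1 + 'b2 \<Rightarrow> 'b1 + 'b2 \<Rightarrow> real" where
  "aggregated_quantity bids p q = (\<Sum>k\<leftarrow>pair_bids bids p q. max_qty k)"

text \<open>
  If the maximum quantities are bounded away from zero, it suffices that the number of bids grows.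
\<close>

lemma aggregated_quantity_at_top:
  fixes bids :: "'n \<Rightarrow> ('b1, 'b2) bid list"
  assumes "\<epsilon> > 0" and qty: "\<And>N k. k \<in> set (bids N) \<Longrightarrow> max_qty k \<ge> \<epsilon>"
    and num: "filterlim (\<lambda>N. length (pair_bids (bids N) p q)) at_top F"
  shows "filterlim (\<lambda>N. aggregated_quantity (bids N) p q) at_top F"
proof (rule filterlim_at_top_mono)
  show "filterlim (\<lambda>N. \<epsilon> * real (length (pair_bids (bids N) p q))) at_top F"
    by (intro filterlim_tendsto_pos_mult_at_top[OF tendsto_const \<open>\<epsilon> > 0\<close>]
        filterlim_compose[OF filterlim_real_sequentially num])
  have *: "\<epsilon> * real (length ks) \<le> (\<Sum>k\<leftarrow>ks. max_qty k)"
    if "\<And>k. k \<in> set ks \<Longrightarrow> max_qty k \<ge> \<epsilon>" for ks :: "('b1, 'b2) bid list"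
    using that by (induction ks) (auto simp: algebra_simps intro: add_mono)
  have "\<epsilon> * real (length (pair_bids (bids N) p q)) \<le> aggregated_quantity (bids N) p q" for N
    unfolding aggregated_quantity_def by (rule *) (auto simp: pair_bids_def intro: qty)
  then show "\<forall>\<^sub>F N in F. \<epsilon> * real (length (pair_bids (bids N) p q)) \<le> aggregated_quantity (bids N) p q"
    by simp
qed

text \<open>
  When the optimum is unique, \<open>arg_min\<close> is that optimum.
\<close>

definition jed_schedule ::
  "('i1::finite, 'b1::finite, 'i2::finite, 'b2::finite, 'l::finite, 'm1::finite, 'm2::finite, 'mt::finite) network
    \<Rightarrow> ('i1, 'b1, 'i2, 'b2) dispatch" where
  "jed_schedule net = arg_min (jed_cost net) (jed_feasible net)"

definition gcts_schedule ::
  "('i1::finite, 'b1::finite, 'i2::finite, 'b2::finite, 'l::finite, 'm1::finite, 'm2::finite, 'mt::finite) network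
    \<Rightarrow> ('b1, 'b2) bid list \<Rightarrow> ('i1, 'b1, 'i2, 'b2) dispatch" where
  "gcts_schedule net bids = fst (arg_min (gcts_cost net bids) (gcts_feasible net bids))"

end

theory Submission
  imports Defs
begin

text \<open>
  Every GCTS schedule is feasible for JED, and the GCTS cost of a JED-feasible schedule is its JED
  cost plus the bid payments. Let \<open>x\<^sub>N\<close>, \<open>s\<^sub>N\<close> be the GCTS optimum. Once the bids are ample
  enough, some \<open>t\<close> clears the interface injections of the JED optimum \<open>x\<^sup>*\<close>; these sum to zero,
  being the nodal injections of a reduced network. The cleared quantities \<open>s\<^sub>N\<close> need not stay
  bounded, but between \<open>s\<^sub>N\<close> and \<open>t\<close> there is another clearing \<open>r\<close> for \<open>x\<^sup>*\<close> whose
  \<open>l\<^sup>1\<close>-distance to \<open>s\<^sub>N\<close> is bounded by the difference of the interface injections, uniformly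
  in the number of bids. Comparing \<open>(x\<^sub>N, s\<^sub>N)\<close> with \<open>(x\<^sup>*, r)\<close>, the payments differ by
  \<open>O(max price)\<close>, so the JED cost of \<open>x\<^sub>N\<close> tends to the optimum. The phase angles determine a
  JED-feasible schedule and range over a compact set, since the Laplacian of a connected network
  is injective on vectors that vanish at the reference bus. Uniqueness of the optimum then gives
  convergence.
\<close>

section \<open>Nonnegative combinations of finitely many vectors\<close>

text \<open>There are only finitely many subsets, and each hull is compact, so a hull that misses 0
  stays a positive distance away. The minimum over all subsets is the source of every later constant
  that is uniform in the number of bids.\<close>

lemma finite_hull_gap:
  fixes V :: "'a::euclidean_space set"
  assumes "finite V"
  obtains \<delta> where "\<delta> > 0"
    "\<forall>S\<subseteq>V. 0 \<notin> convex hull S \<longrightarrow> (\<forall>x\<in>convex hull S. \<delta> \<le> norm x)"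
proof -
  have "\<exists>d>0. 0 \<notin> convex hull S \<longrightarrow> (\<forall>x\<in>convex hull S. d \<le> norm x)" if "S \<in> Pow V" for S
  proof (cases "0 \<in> convex hull S")
    case True
    then show ?thesis by (auto intro: exI[of _ 1])
  next
    case False
    have "finite S" using that assms finite_subset by auto
    then have "closed (convex hull S)"
      by (simp add: finite_imp_compact_convex_hull compact_imp_closed)
    from separate_point_closed[OF this False] show ?thesis by auto
  qed
  then obtain d where d: "\<And>S. S \<in> Pow V \<Longrightarrow> d S > 0"
      "\<And>S x. \<lbrakk>S \<in> Pow V; 0 \<notin> convex hull S; x \<in> convex hull S\<rbrakk> \<Longrightarrow> d S \<le> norm x"
    by metis
  have fin: "finite (d ` Pow V)" using assms by simp
  show thesis
  proof (rule that[of "Min (d ` Pow V)"])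
    show "Min (d ` Pow V) > 0"
      by (subst Min_gr_iff) (use fin d(1) in auto)
    have "Min (d ` Pow V) \<le> norm x"
      if "S \<subseteq> V" "0 \<notin> convex hull S" "x \<in> convex hull S" for S x
      using d(2)[of S x] Min_le[OF fin, of "d S"] that by force
    then show "\<forall>S\<subseteq>V. 0 \<notin> convex hull S \<longrightarrow> (\<forall>x\<in>convex hull S. Min (d ` Pow V) \<le> norm x)"
      by blast
  qed
qed

text \<open>Weights sit on indices rather than on vectors because several bids may share one column;
  each vector hands its weight to a single representative index in \<open>L\<close>.\<close>

lemma convex_hull_image_nonneg:
  fixes c :: "'k \<Rightarrow> 'a::euclidean_space"
  assumes "finite K" "x \<in> convex hull (c ` K)"
  obtains z where "\<And>k. k \<in> K \<Longrightarrow> 0 \<le> z k" "sum z K = 1" "(\<Sum>k\<in>K. z k *\<^sub>R c k) = x"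
proof -
  obtain L where L: "L \<subseteq> K" "inj_on c L" "c ` K = c ` L"
    by (metis subset_image_inj order_refl)
  have finL: "finite L" using L(1) assms(1) finite_subset by blast
  from assms(2) obtain u where u: "\<forall>y\<in>c ` L. 0 \<le> u y" "sum u (c ` L) = 1"
      "(\<Sum>y\<in>c ` L. u y *\<^sub>R y) = x"
    unfolding L(3) by (subst (asm) convex_hull_finite) (use finL in auto)
  define z where "z k = (if k \<in> L then u (c k) else 0)" for k
  have "sum z K = (\<Sum>k\<in>L. u (c k))"
    unfolding z_def by (rule sum.mono_neutral_cong_right) (use assms L in auto)
  also have "\<dots> = 1" using u(2) by (simp add: sum.reindex[OF L(2)])
  finally have 1: "sum z K = 1" .
  have "(\<Sum>k\<in>K. z k *\<^sub>R c k) = (\<Sum>k\<in>L. u (c k) *\<^sub>R c k)"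
    unfolding z_def by (rule sum.mono_neutral_cong_right) (use assms L in auto)
  also have "\<dots> = x" using u(3) by (simp add: sum.reindex[OF L(2)])
  finally show thesis
    using that[of z] 1 u(1) by (auto simp: z_def)
qed

text \<open>
  While \<open>0\<close> lies in the convex hull of the columns in use, subtracting a multiple of that
  relation removes a column; once it does not, the hull stays away from \<open>0\<close>.
\<close>

lemma nonneg_combination_reduce:
  fixes c :: "'k \<Rightarrow> 'a::euclidean_space"
  assumes gap: "\<forall>S\<subseteq>V. 0 \<notin> convex hull S \<longrightarrow> (\<forall>x\<in>convex hull S. \<delta> \<le> norm x)"
    and K: "finite K" "c ` K \<subseteq> V" and w: "\<And>k. k \<in> K \<Longrightarrow> 0 \<le> w k"
  shows "\<exists>w'. (\<forall>k\<in>K. 0 \<le> w' k \<and> w' k \<le> w k) \<and>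
           (\<Sum>k\<in>K. w' k *\<^sub>R c k) = (\<Sum>k\<in>K. w k *\<^sub>R c k) \<and>
           \<delta> * sum w' K \<le> norm (\<Sum>k\<in>K. w k *\<^sub>R c k)"
  using w
proof (induction "card {k\<in>K. w k \<noteq> 0}" arbitrary: w rule: less_induct)
  case less
  define A where "A = {k\<in>K. w k \<noteq> 0}"
  have A: "finite A" "A \<subseteq> K" using K by (auto simp: A_def)
  have sumA: "sum w K = sum w A" "(\<Sum>k\<in>K. w k *\<^sub>R c k) = (\<Sum>k\<in>A. w k *\<^sub>R c k)"
    by (rule sum.mono_neutral_right; use K in \<open>auto simp: A_def\<close>)+
  have posA: "w k > 0" if "k \<in> A" for k
    using that less.prems[of k] by (auto simp: A_def)
  consider "A = {}" | "A \<noteq> {}" "0 \<notin> convex hull (c ` A)" | "0 \<in> convex hull (c ` A)" by blast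
  then show ?case
  proof cases
    case 1
    then show ?thesis using less.prems sumA by (intro exI[of _ w]) auto
  next
    case 2
    \<comment> \<open>Normalised by \<open>W\<close>, the sum is a point of the hull, so the gap
      bounds the total weight.\<close>
    define W where "W = sum w A"
    have W: "W > 0" unfolding W_def using A(1) 2(1) posA by (rule sum_pos)
    have "(\<Sum>k\<in>A. (w k / W) *\<^sub>R c k) \<in> convex hull (c ` A)"
    proof (rule convex_sum)
      show "(\<Sum>k\<in>A. w k / W) = 1" using W by (simp add: W_def flip: sum_divide_distrib)
    qed (use A W posA in \<open>auto simp: hull_inc less_imp_le\<close>)
    moreover have "(\<Sum>k\<in>A. (w k / W) *\<^sub>R c k) = (1 / W) *\<^sub>R (\<Sum>k\<in>A. w k *\<^sub>R c k)"
      by (simp add: scaleR_sum_right)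
    ultimately have "\<delta> \<le> norm ((1 / W) *\<^sub>R (\<Sum>k\<in>A. w k *\<^sub>R c k))"
      using gap 2 A(2) K(2) by (metis image_mono order_trans)
    then have "\<delta> * W \<le> norm (\<Sum>k\<in>A. w k *\<^sub>R c k)"
      using W by (simp add: field_simps)
    then show ?thesis using less.prems sumA by (intro exI[of _ w]) (auto simp: W_def)
  next
    case 3
    obtain z where z: "\<And>k. k \<in> A \<Longrightarrow> 0 \<le> z k" "sum z A = 1" "(\<Sum>k\<in>A. z k *\<^sub>R c k) = 0"
      using convex_hull_image_nonneg[OF A(1) 3] by metis
    define B where "B = {k\<in>A. z k > 0}"
    have "B \<noteq> {}"
    proof
      assume "B = {}"
      then have "sum z A = 0" using z(1) by (force simp: B_def intro: sum.neutral)
      then show False using z(2) by simp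
    qed
    have finB: "finite B" using A by (auto simp: B_def)
    \<comment> \<open>The largest multiple of the relation that keeps all coefficients nonnegative;
      the index \<open>j\<close> attaining the minimum leaves the support, whose size drives the
      induction.\<close>
    define t where "t = Min ((\<lambda>k. w k / z k) ` B)"
    obtain j where j: "j \<in> B" "t = w j / z j"
      using Min_in[of "(\<lambda>k. w k / z k) ` B"] finB \<open>B \<noteq> {}\<close> unfolding t_def by fast
    have t0: "t \<ge> 0" using j posA by (auto simp: B_def less_imp_le)
    have tle: "t * z k \<le> w k" if "k \<in> A" for k
    proof (cases "k \<in> B")
      case True
      then have "t \<le> w k / z k" using finB by (auto simp: t_def)
      then show ?thesis using True by (simp add: B_def field_simps)
    next
      case False
      then have "z k = 0" using that z(1)[OF that] by (auto simp: B_def)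
      then show ?thesis using posA[OF that] by simp
    qed
    define w2 where "w2 k = (if k \<in> A then w k - t * z k else 0)" for k
    have w2: "0 \<le> w2 k" "w2 k \<le> w k" if "k \<in> K" for k
      using tle t0 z(1) less.prems[OF that] by (auto simp: w2_def)
    have s2: "(\<Sum>k\<in>K. w2 k *\<^sub>R c k) = (\<Sum>k\<in>K. w k *\<^sub>R c k)"
    proof -
      have "(\<Sum>k\<in>K. w2 k *\<^sub>R c k) = (\<Sum>k\<in>A. (w k - t * z k) *\<^sub>R c k)"
        unfolding w2_def by (rule sum.mono_neutral_cong_right) (use K A in auto)
      also have "\<dots> = (\<Sum>k\<in>A. w k *\<^sub>R c k) - t *\<^sub>R (\<Sum>k\<in>A. z k *\<^sub>R c k)"
        by (simp add: scaleR_diff_left sum_subtractf scaleR_sum_right)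
      finally show ?thesis using z(3) sumA by simp
    qed
    have "w2 j = 0" using j by (auto simp: w2_def B_def)
    then have "{k\<in>K. w2 k \<noteq> 0} \<subseteq> A - {j}" by (auto simp: w2_def)
    then have "{k\<in>K. w2 k \<noteq> 0} \<subset> A" using j by (auto simp: B_def)
    then have "card {k\<in>K. w2 k \<noteq> 0} < card {k\<in>K. w k \<noteq> 0}"
      using A(1) by (simp add: A_def psubset_card_mono)
    from less.hyps[OF this w2(1)] obtain w' where
      "\<forall>k\<in>K. 0 \<le> w' k \<and> w' k \<le> w2 k" "(\<Sum>k\<in>K. w' k *\<^sub>R c k) = (\<Sum>k\<in>K. w2 k *\<^sub>R c k)"
      "\<delta> * sum w' K \<le> norm (\<Sum>k\<in>K. w2 k *\<^sub>R c k)"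
      by metis
    then show ?thesis using w2(2) s2 by (intro exI[of _ w']) (auto intro: order_trans)
  qed
qed

text \<open>
  A Hoffman-type bound whose constant does not depend on the number of variables, only on the
  finite set of vectors that may occur as columns.
\<close>

lemma box_solution_near:
  fixes V :: "'a::euclidean_space set"
  assumes "finite V"
  obtains C where "C \<ge> 0"
    "\<And>(K :: 'k set) c s t. \<lbrakk>finite K; c ` K \<subseteq> V\<rbrakk> \<Longrightarrow>
       \<exists>r. (\<forall>k\<in>K. min (s k) (t k) \<le> r k \<and> r k \<le> max (s k) (t k)) \<and>
           (\<Sum>k\<in>K. r k *\<^sub>R c k) = (\<Sum>k\<in>K. t k *\<^sub>R c k) \<and>
           (\<Sum>k\<in>K. \<bar>r k - s k\<bar>) \<le> C * norm ((\<Sum>k\<in>K. t k *\<^sub>R c k) - (\<Sum>k\<in>K. s k *\<^sub>R c k))"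
proof -
  \<comment> \<open>Both signs of each column occur, since an entry may have to move up or
    down.\<close>
  define V' where "V' = V \<union> uminus ` V"
  have "finite V'" using assms by (simp add: V'_def)
  then obtain \<delta> where \<delta>: "\<delta> > 0"
    "\<forall>S\<subseteq>V'. 0 \<notin> convex hull S \<longrightarrow> (\<forall>x\<in>convex hull S. \<delta> \<le> norm x)"
    using finite_hull_gap by metis
  show thesis
  proof (rule that[of "1 / \<delta>"])
    show "1 / \<delta> \<ge> 0" using \<delta>(1) by simp
    fix K :: "'k set" and c :: "'k \<Rightarrow> 'a" and s t :: "'k \<Rightarrow> real"
    assume K: "finite K" "c ` K \<subseteq> V"
    \<comment> \<open>Orienting each column in the direction from \<open>s\<close> to
      \<open>t\<close> turns the correction into a combination with nonnegative weights.\<close>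
    define \<sigma> where "\<sigma> k = (if s k \<le> t k then 1 else - 1 :: real)" for k :: 'k
    have "(\<lambda>k :: 'k. \<sigma> k *\<^sub>R c k) ` K \<subseteq> V'" using K(2) by (auto simp: V'_def \<sigma>_def image_subset_iff)
    from nonneg_combination_reduce[OF \<delta>(2) K(1) this, where w = "\<lambda>k. \<bar>t k - s k\<bar>"]
    obtain w where w: "\<forall>k\<in>K. 0 \<le> w k \<and> w k \<le> \<bar>t k - s k\<bar>"
        "(\<Sum>k\<in>K. w k *\<^sub>R \<sigma> k *\<^sub>R c k) = (\<Sum>k\<in>K. \<bar>t k - s k\<bar> *\<^sub>R \<sigma> k *\<^sub>R c k)"
        "\<delta> * sum w K \<le> norm (\<Sum>k\<in>K. \<bar>t k - s k\<bar> *\<^sub>R \<sigma> k *\<^sub>R c k)"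
      by auto
    have "\<bar>t k - s k\<bar> *\<^sub>R \<sigma> k *\<^sub>R c k = t k *\<^sub>R c k - s k *\<^sub>R c k" for k :: 'k
      by (auto simp: \<sigma>_def scaleR_diff_left)
    then have d: "(\<Sum>k\<in>K. \<bar>t k - s k\<bar> *\<^sub>R \<sigma> k *\<^sub>R c k) = (\<Sum>k\<in>K. t k *\<^sub>R c k) - (\<Sum>k\<in>K. s k *\<^sub>R c k)"
      by (simp add: sum_subtractf)
    \<comment> \<open>Reduced weights never exceed the full step, so \<open>r k\<close> stays
      between \<open>s k\<close> and \<open>t k\<close>; their sum is the distance moved.\<close>
    define r where "r k = s k + w k * \<sigma> k" for k
    show "\<exists>r. (\<forall>k\<in>K. min (s k) (t k) \<le> r k \<and> r k \<le> max (s k) (t k)) \<and>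
           (\<Sum>k\<in>K. r k *\<^sub>R c k) = (\<Sum>k\<in>K. t k *\<^sub>R c k) \<and>
           (\<Sum>k\<in>K. \<bar>r k - s k\<bar>) \<le> 1 / \<delta> * norm ((\<Sum>k\<in>K. t k *\<^sub>R c k) - (\<Sum>k\<in>K. s k *\<^sub>R c k))"
    proof (intro exI[of _ r] conjI)
      show "\<forall>k\<in>K. min (s k) (t k) \<le> r k \<and> r k \<le> max (s k) (t k)"
        using w(1) by (force simp: r_def \<sigma>_def min_def max_def)
      have "(\<Sum>k\<in>K. r k *\<^sub>R c k) = (\<Sum>k\<in>K. s k *\<^sub>R c k) + (\<Sum>k\<in>K. w k *\<^sub>R \<sigma> k *\<^sub>R c k)"
        by (simp add: r_def scaleR_add_left sum.distrib)
      then show "(\<Sum>k\<in>K. r k *\<^sub>R c k) = (\<Sum>k\<in>K. t k *\<^sub>R c k)"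
        using w(2) d by simp
      have "(\<Sum>k\<in>K. \<bar>r k - s k\<bar>) = sum w K"
        using w(1) by (intro sum.cong) (auto simp: r_def \<sigma>_def abs_mult)
      then show "(\<Sum>k\<in>K. \<bar>r k - s k\<bar>) \<le> 1 / \<delta> * norm ((\<Sum>k\<in>K. t k *\<^sub>R c k) - (\<Sum>k\<in>K. s k *\<^sub>R c k))"
        using w(3)[unfolded d] \<delta>(1) by (simp add: field_simps)
    qed
  qed
qed

section \<open>The nodal matrix\<close>

text \<open>The entry for line \<open>l\<close> and bus \<open>u\<close> of the oriented incidence
  matrix of the network graph.\<close>

definition bus_sign where
  "bus_sign net l u = (of_bool (u = line_from net l) - of_bool (u = line_to net l) :: real)"

text \<open>Factors the Laplacian through the incidence matrix. A loop would count on the diagonal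
  of \<open>nodal_matrix\<close> while its two signs cancel, hence the assumption.\<close>

lemma nodal_matrix_bus_sign:
  assumes "\<And>l. line_from net l \<noteq> line_to net l"
  shows "nodal_matrix net $ u $ v = (\<Sum>l\<in>UNIV. bus_sign net l u * bus_sign net l v / reactance net l)"
proof (cases "u = v")
  case True
  have "(\<Sum>l | u \<in> line_ends net l. 1 / reactance net l)
      = (\<Sum>l\<in>UNIV. bus_sign net l u * bus_sign net l v / reactance net l)"
    by (rule sum.mono_neutral_cong_left)
      (use True assms in \<open>auto simp: bus_sign_def line_ends_def\<close>)
  then show ?thesis using True by (simp add: nodal_matrix_def)
next
  case False
  have "(\<Sum>l | line_ends net l = {u, v}. - (1 / reactance net l))
      = (\<Sum>l\<in>UNIV. bus_sign net l u * bus_sign net l v / reactance net l)"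
    by (rule sum.mono_neutral_cong_left)
      (use False assms in \<open>auto simp: bus_sign_def line_ends_def doubleton_eq_iff\<close>)
  then show ?thesis using False by (simp add: nodal_matrix_def sum_negf)
qed

lemma sum_bus_sign: "(\<Sum>v\<in>UNIV. bus_sign net l v * f v) = f (line_from net l) - f (line_to net l)"
  for net :: "('i1::finite, 'b1::finite, 'i2::finite, 'b2::finite, 'l::finite, 'm1::finite, 'm2::finite, 'mt::finite) network"
  by (simp add: bus_sign_def left_diff_distrib sum_subtractf)

lemma nodal_matrix_mult:
  assumes "\<And>l. line_from net l \<noteq> line_to net l"
  shows "(nodal_matrix net *v \<theta>) $ u
    = (\<Sum>l\<in>UNIV. bus_sign net l u * (\<theta> $ line_from net l - \<theta> $ line_to net l) / reactance net l)"
proof -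
  have "(nodal_matrix net *v \<theta>) $ u
    = (\<Sum>v\<in>UNIV. \<Sum>l\<in>UNIV. bus_sign net l u / reactance net l * (bus_sign net l v * \<theta> $ v))"
    by (simp add: matrix_vector_mult_def nodal_matrix_bus_sign[OF assms] sum_distrib_left mult_ac)
  also have "\<dots> = (\<Sum>l\<in>UNIV. bus_sign net l u / reactance net l * (\<Sum>v\<in>UNIV. bus_sign net l v * \<theta> $ v))"
    by (subst sum.swap) (simp add: sum_distrib_left)
  finally show ?thesis by (simp add: sum_bus_sign)
qed

text \<open>Summation by parts: swapping the sums over buses and lines moves the signs onto
  \<open>\<phi>\<close>. For \<open>\<phi> = \<theta>\<close> this is the Dirichlet energy.\<close>

lemma nodal_matrix_energy:
  assumes "\<And>l. line_from net l \<noteq> line_to net l"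
  shows "\<phi> \<bullet> (nodal_matrix net *v \<theta>)
    = (\<Sum>l\<in>UNIV. (\<phi> $ line_from net l - \<phi> $ line_to net l) * (\<theta> $ line_from net l - \<theta> $ line_to net l) / reactance net l)"
proof -
  have "\<phi> \<bullet> (nodal_matrix net *v \<theta>)
    = (\<Sum>u\<in>UNIV. \<Sum>l\<in>UNIV. (\<theta> $ line_from net l - \<theta> $ line_to net l) / reactance net l * (bus_sign net l u * \<phi> $ u))"
    by (simp add: inner_vec_def nodal_matrix_mult[OF assms] sum_distrib_left mult_ac)
  also have "\<dots> = (\<Sum>l\<in>UNIV. (\<theta> $ line_from net l - \<theta> $ line_to net l) / reactance net l * (\<Sum>u\<in>UNIV. bus_sign net l u * \<phi> $ u))"
    by (subst sum.swap) (simp add: sum_distrib_left)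
  finally show ?thesis unfolding sum_bus_sign by (simp add: mult_ac)
qed

lemma nodal_matrix_sum_zero:
  assumes "\<And>l. line_from net l \<noteq> line_to net l"
  shows "(\<Sum>u\<in>UNIV. (nodal_matrix net *v \<theta>) $ u) = 0"
  using nodal_matrix_energy[OF assms, where \<phi> = 1 and \<theta> = \<theta>] by (simp add: inner_vec_def)

text \<open>Positive reactances make the energy a weighted sum of squares, so the two ends of each
  line agree; connectivity spreads this to all buses.\<close>

lemma zero_energy_constant:
  assumes "dc_network net" "\<theta> \<bullet> (nodal_matrix net *v \<theta>) = 0"
  shows "\<theta> $ u = \<theta> $ v"
proof -
  have net: "\<And>l. line_from net l \<noteq> line_to net l" "\<And>l. reactance net l > 0" "connected_network net"
    using assms(1) by (auto simp: dc_network_def)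
  have "(\<Sum>l\<in>UNIV. (\<theta> $ line_from net l - \<theta> $ line_to net l)\<^sup>2 / reactance net l) = 0"
    using assms(2) unfolding nodal_matrix_energy[OF net(1)] by (simp add: power2_eq_square)
  then have eq: "\<theta> $ line_from net l = \<theta> $ line_to net l" for l
    using net(2) by (subst (asm) sum_nonneg_eq_0_iff) (auto simp: less_imp_le less_imp_neq[symmetric] dest: spec[of _ l])
  have "(u, v) \<in> {(x, y). \<exists>l. line_ends net l = {x, y}}\<^sup>*"
    using net(3) by (simp add: connected_network_def)
  then show ?thesis
  proof (induction rule: rtrancl_induct)
    case (step y z)
    then show ?case using eq by (auto simp: line_ends_def doubleton_eq_iff)
  qed simp
qed

lemma zero_energy_zero:
  assumes "dc_network net" "\<theta> \<bullet> (nodal_matrix net *v \<theta>) = 0" "\<theta> $ v = 0"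
  shows "\<theta> = 0"
  using zero_energy_constant[OF assms(1,2), of _ v] assms(3) by (simp add: vec_eq_iff)

text \<open>A line between the areas is a tie-line, and \<open>dc_network\<close> makes both of its
  ends boundary buses.\<close>

lemma nodal_matrix_cross_zero:
  assumes "dc_network net" "isl u \<noteq> isl v" "\<not> is_boundary u \<or> \<not> is_boundary v"
  shows "nodal_matrix net $ u $ v = 0"
proof -
  have "line_ends net l \<noteq> {u, v}" for l
  proof
    assume *: "line_ends net l = {u, v}"
    then have "l \<in> tie_lines net"
      using assms(2) by (auto simp: line_ends_def tie_lines_def doubleton_eq_iff)
    then have "is_boundary u" "is_boundary v"
      using assms(1) * by (auto simp: dc_network_def)
    then show False using assms(3) by simp
  qed
  then show ?thesis using assms(2) by (auto simp: nodal_matrix_def)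
qed

lemma matrix_inv_right:
  fixes A :: "real ^ 'n ^ 'm"
  assumes "invertible A"
  shows "A ** matrix_inv A = mat 1"
  using someI_ex[OF assms[unfolded invertible_def]] by (simp add: matrix_inv_def)

text \<open>A kernel vector extended by zero has no energy: injections vanish on
  \<open>range p\<close>, angles vanish elsewhere. The omitted bus \<open>v\<close> then forces the
  constant angle to be 0.\<close>

lemma principal_block_invertible:
  fixes p :: "'a::finite \<Rightarrow> _"
  assumes "dc_network net" "inj p" "v \<notin> range p"
  shows "invertible (block p p (nodal_matrix net))"
proof -
  let ?A = "block p p (nodal_matrix net)"
  have "x = 0" if x: "?A *v x = 0" for x
  proof -
    define \<theta> where "\<theta> = (\<chi> u. if u \<in> range p then x $ inv p u else 0)"
    have \<theta>p: "\<theta> $ p i = x $ i" for i using assms(2) by (simp add: \<theta>_def)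
    have *: "(nodal_matrix net *v \<theta>) $ p i = 0" for i
    proof -
      have "(nodal_matrix net *v \<theta>) $ p i = (\<Sum>u\<in>range p. nodal_matrix net $ p i $ u * \<theta> $ u)"
        unfolding matrix_vector_mult_def
        by (simp, rule sum.mono_neutral_right) (auto simp: \<theta>_def)
      also have "\<dots> = (?A *v x) $ i"
        by (simp add: sum.reindex[OF assms(2)] \<theta>p matrix_vector_mult_def block_def)
      finally show ?thesis using x by simp
    qed
    have "\<theta> \<bullet> (nodal_matrix net *v \<theta>) = 0"
      unfolding inner_vec_def using * by (intro sum.neutral) (auto simp: \<theta>_def)
    moreover have "\<theta> $ v = 0" using assms(3) by (simp add: \<theta>_def)
    ultimately have "\<theta> = 0" using assms(1) by (rule zero_energy_zero[rotated])
    then show "x = 0" using \<theta>p by (simp add: vec_eq_iff)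
  qed
  then show ?thesis
    unfolding invertible_left_inverse matrix_left_invertible_ker by blast
qed

section \<open>Block form of the nodal equations\<close>

lemma sum_bus:
  fixes f :: "('i1::finite, 'b1::finite, 'i2::finite, 'b2::finite) bus \<Rightarrow> 'a::comm_monoid_add"
  shows "(\<Sum>u\<in>UNIV. f u) = (\<Sum>i\<in>UNIV. f (int1 i)) + (\<Sum>b\<in>UNIV. f (bnd1 b))
     + ((\<Sum>i\<in>UNIV. f (int2 i)) + (\<Sum>b\<in>UNIV. f (bnd2 b)))"
  by (simp add: sum.Plus flip: UNIV_Plus_UNIV)

definition restrict_vec :: "('a::finite \<Rightarrow> 'n::finite) \<Rightarrow> real ^ 'n \<Rightarrow> real ^ 'a" where
  "restrict_vec p \<theta> = (\<chi> i. \<theta> $ p i)"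

lemma restrict_vec_nth [simp]: "restrict_vec p \<theta> $ i = \<theta> $ p i"
  by (simp add: restrict_vec_def)

lemma continuous_on_restrict_vec [continuous_intros]:
  "continuous_on S f \<Longrightarrow> continuous_on S (\<lambda>x. restrict_vec p (f x))"
  unfolding restrict_vec_def by (intro continuous_intros)

text \<open>The blocks joining internal buses to the other area vanish. This translates between the
  block equations of \<open>power_flow\<close> and the whole bus vector.\<close>

lemma restrict_nodal_matrix:
  assumes "dc_network net"
  defines "Y \<equiv> nodal_matrix net"
  shows "restrict_vec int1 (Y *v \<theta>) = block int1 int1 Y *v restrict_vec int1 \<theta> + block int1 bnd1 Y *v restrict_vec bnd1 \<theta>"
    and "restrict_vec bnd1 (Y *v \<theta>) = block bnd1 int1 Y *v restrict_vec int1 \<theta> + block bnd1 bnd1 Y *v restrict_vec bnd1 \<theta>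
           + block bnd1 bnd2 Y *v restrict_vec bnd2 \<theta>"
    and "restrict_vec bnd2 (Y *v \<theta>) = block bnd2 bnd1 Y *v restrict_vec bnd1 \<theta> + block bnd2 bnd2 Y *v restrict_vec bnd2 \<theta>
           + block bnd2 int2 Y *v restrict_vec int2 \<theta>"
    and "restrict_vec int2 (Y *v \<theta>) = block int2 bnd2 Y *v restrict_vec bnd2 \<theta> + block int2 int2 Y *v restrict_vec int2 \<theta>"
proof -
  have nb: "\<not> is_boundary (int1 i)" "\<not> is_boundary (int2 j)" for i j
    by (auto simp: is_boundary_def)
  note z = nodal_matrix_cross_zero[OF assms(1), folded Y_def]
  have [simp]: "Y $ int1 i $ int2 j = 0" "Y $ int2 j $ int1 i = 0" "Y $ int1 i $ bnd2 c = 0"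
     "Y $ bnd2 c $ int1 i = 0" "Y $ int2 j $ bnd1 b = 0" "Y $ bnd1 b $ int2 j = 0" for i j b c
    by (rule z; simp add: nb)+
  note d = vec_eq_iff matrix_vector_mult_def sum_bus block_def
  show "restrict_vec int1 (Y *v \<theta>) = block int1 int1 Y *v restrict_vec int1 \<theta> + block int1 bnd1 Y *v restrict_vec bnd1 \<theta>"
    and "restrict_vec bnd1 (Y *v \<theta>) = block bnd1 int1 Y *v restrict_vec int1 \<theta> + block bnd1 bnd1 Y *v restrict_vec bnd1 \<theta>
           + block bnd1 bnd2 Y *v restrict_vec bnd2 \<theta>"
    and "restrict_vec bnd2 (Y *v \<theta>) = block bnd2 bnd1 Y *v restrict_vec bnd1 \<theta> + block bnd2 bnd2 Y *v restrict_vec bnd2 \<theta>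
           + block bnd2 int2 Y *v restrict_vec int2 \<theta>"
    and "restrict_vec int2 (Y *v \<theta>) = block int2 bnd2 Y *v restrict_vec bnd2 \<theta> + block int2 int2 Y *v restrict_vec int2 \<theta>"
    by (simp_all add: d)
qed

section \<open>Interface injections, the left-hand sides of the clearing equations\<close>

definition interface1 where
  "interface1 net \<theta>1 \<theta>2 = reduced_block bnd1 int1 (nodal_matrix net) *v \<theta>1 + block bnd1 bnd2 (nodal_matrix net) *v \<theta>2"

definition interface2 where
  "interface2 net \<theta>1 \<theta>2 = block bnd2 bnd1 (nodal_matrix net) *v \<theta>1 + reduced_block bnd2 int2 (nodal_matrix net) *v \<theta>2"

text \<open>
  Choosing the internal angles so that the internal injections vanish turns the interface
  injections into the full vector of nodal injections, which always sums to zero.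
\<close>

lemma interface_sum_zero:
  assumes net: "dc_network net"
  shows "(\<Sum>b\<in>UNIV. interface1 net \<theta>1 \<theta>2 $ b) + (\<Sum>b\<in>UNIV. interface2 net \<theta>1 \<theta>2 $ b) = 0"
proof -
  let ?Y = "nodal_matrix net"
  \<comment> \<open>\<open>undefined\<close> merely names some bus outside the block.\<close>
  have inv1: "invertible (block int1 int1 ?Y)"
    by (rule principal_block_invertible[OF net, where v = "bnd1 undefined"]) (auto simp: inj_on_def)
  have inv2: "invertible (block int2 int2 ?Y)"
    by (rule principal_block_invertible[OF net, where v = "bnd2 undefined"]) (auto simp: inj_on_def)
  define z1 where "z1 = matrix_inv (block int1 int1 ?Y) *v (block int1 bnd1 ?Y *v \<theta>1)"
  define z2 where "z2 = matrix_inv (block int2 int2 ?Y) *v (block int2 bnd2 ?Y *v \<theta>2)"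
  have z: "block int1 int1 ?Y *v z1 = block int1 bnd1 ?Y *v \<theta>1" "block int2 int2 ?Y *v z2 = block int2 bnd2 ?Y *v \<theta>2"
    unfolding z1_def z2_def
    by (simp_all only: matrix_vector_mul_assoc matrix_mul_assoc matrix_inv_right[OF inv1]
        matrix_inv_right[OF inv2] matrix_mul_lid)
  \<comment> \<open>\<open>bus_angle\<close> is used only to assemble four blocks into one bus
    vector, so the generation fields are dummies. The minus signs cancel the internal
    injections.\<close>
  define \<eta> where "\<eta> = (\<chi> u. bus_angle \<lparr>gen1 = 0, gen2 = 0, ang1 = - z1, ang2 = - z2, bang1 = \<theta>1, bang2 = \<theta>2\<rparr> u)"
  have \<eta>: "restrict_vec int1 \<eta> = - z1" "restrict_vec int2 \<eta> = - z2" "restrict_vec bnd1 \<eta> = \<theta>1" "restrict_vec bnd2 \<eta> = \<theta>2"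
    by (simp_all add: \<eta>_def vec_eq_iff)
  have neg: "A *v (- x) = - (A *v x)" for A :: "real ^ 'y ^ 'z" and x
    using matrix_vector_mult_diff_distrib[of A 0 x] by simp
  note r = restrict_nodal_matrix[OF net, of \<eta>, unfolded \<eta>]
  have "restrict_vec int1 (?Y *v \<eta>) = 0" "restrict_vec int2 (?Y *v \<eta>) = 0"
    unfolding r by (simp_all add: neg z)
  moreover have "restrict_vec bnd1 (?Y *v \<eta>) = interface1 net \<theta>1 \<theta>2"
    unfolding r interface1_def reduced_block_def
    by (simp add: neg z1_def matrix_vector_mult_diff_rdistrib flip: matrix_vector_mul_assoc)
  moreover have "restrict_vec bnd2 (?Y *v \<eta>) = interface2 net \<theta>1 \<theta>2"
    unfolding r interface2_def reduced_block_def
    by (simp add: neg z2_def matrix_vector_mult_diff_rdistrib flip: matrix_vector_mul_assoc)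
  ultimately have "(?Y *v \<eta>) $ int1 i = 0" "(?Y *v \<eta>) $ int2 j = 0"
    "(?Y *v \<eta>) $ bnd1 b = interface1 net \<theta>1 \<theta>2 $ b" "(?Y *v \<eta>) $ bnd2 c = interface2 net \<theta>1 \<theta>2 $ c" for i j b c
    by (simp_all add: vec_eq_iff)
  moreover have "(\<Sum>u\<in>UNIV. (?Y *v \<eta>) $ u) = 0"
    by (rule nodal_matrix_sum_zero) (use net in \<open>simp add: dc_network_def\<close>)
  ultimately show ?thesis by (simp add: sum_bus)
qed

section \<open>Clearing of interface bids\<close>

text \<open>The column of bid \<open>k\<close> in the two incidence matrices stacked, so that
  clearing becomes one vector equation.\<close>

definition bid_vector :: "('b1::finite, 'b2::finite) bid \<Rightarrow> real ^ ('b1 + 'b2)" where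
  "bid_vector k = (\<chi> b. incidence k b)"

text \<open>A column depends only on source and sink. Hence one constant of
  \<open>box_solution_near\<close> serves all lists of bids.\<close>

lemma finite_range_bid_vector: "finite (range (bid_vector :: ('b1::finite, 'b2::finite) bid \<Rightarrow> _))"
proof (rule finite_subset)
  show "range (bid_vector :: ('b1, 'b2) bid \<Rightarrow> _) \<subseteq> (\<lambda>(p, q). \<chi> b. if b = p then 1 else if b = q then - 1 else 0) ` UNIV"
  proof (rule image_subsetI)
    fix k :: "('b1, 'b2) bid"
    have "bid_vector k = (\<lambda>(p, q). \<chi> b. if b = p then 1 else if b = q then - 1 else 0) (source k, sink k)"
      by (simp add: bid_vector_def incidence_def)
    then show "bid_vector k \<in> (\<lambda>(p, q). \<chi> b. if b = p then 1 else if b = q then - 1 else 0) ` UNIV"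
      by blast
  qed
qed simp

definition interface where
  "interface net \<theta>1 \<theta>2 =
     (\<chi> b. case b of Inl p \<Rightarrow> interface1 net \<theta>1 \<theta>2 $ p | Inr q \<Rightarrow> interface2 net \<theta>1 \<theta>2 $ q)"

text \<open>Separates JED feasibility from the bids, which enter only through box bounds and one
  linear equation, the shape that \<open>box_solution_near\<close> handles.\<close>

lemma gcts_feasible_iff:
  "gcts_feasible net bids (x, s) \<longleftrightarrow>
     jed_feasible net x \<and> length s = length bids \<and>
     (\<forall>k<length bids. 0 \<le> s ! k \<and> s ! k \<le> max_qty (bids ! k)) \<and>
     (\<Sum>k<length bids. s ! k *\<^sub>R bid_vector (bids ! k)) = interface net (bang1 x) (bang2 x)"
proof -
  have "(\<Sum>k<length bids. s ! k *\<^sub>R bid_vector (bids ! k)) = interface net (bang1 x) (bang2 x)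
    \<longleftrightarrow> interface1 net (bang1 x) (bang2 x) = bid_injection1 bids s \<and>
        interface2 net (bang1 x) (bang2 x) = bid_injection2 bids s"
    by (auto simp: vec_eq_iff interface_def bid_injection1_def bid_injection2_def bid_vector_def
        mult.commute split: sum.splits)
  then show ?thesis
    by (auto simp: gcts_feasible_def jed_feasible_def interface1_def interface2_def Let_def)
qed

text \<open>The weight \<open>h\<close> is common to all bids of a pair, so their maximum quantities
  can be pooled.\<close>

lemma sum_bids_by_pair:
  fixes bids :: "('b1::finite, 'b2::finite) bid list"
  shows "(\<Sum>k<length bids. max_qty (bids ! k) * h (source (bids ! k)) (sink (bids ! k)))
    = (\<Sum>p\<in>UNIV. \<Sum>q\<in>UNIV. aggregated_quantity bids p q * h p q)"
proof -
  have "(\<Sum>k<length bids. max_qty (bids ! k) * h (source (bids ! k)) (sink (bids ! k)))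
     = (\<Sum>k\<leftarrow>bids. max_qty k * h (source k) (sink k))"
    by (simp add: sum_list_sum_nth atLeast0LessThan)
  also have "\<dots> = (\<Sum>p\<in>UNIV. \<Sum>q\<in>UNIV. aggregated_quantity bids p q * h p q)"
  proof (induction bids)
    case (Cons k ks)
    have "aggregated_quantity (k # ks) p q * h p q
        = (if p = source k then if q = sink k then max_qty k * h p q else 0 else 0)
          + aggregated_quantity ks p q * h p q" for p q
      by (simp add: aggregated_quantity_def pair_bids_def distrib_right)
    then have "(\<Sum>p\<in>UNIV. \<Sum>q\<in>UNIV. aggregated_quantity (k # ks) p q * h p q)
      = (\<Sum>p\<in>UNIV. \<Sum>q\<in>UNIV. if p = source k then if q = sink k then max_qty k * h p q else 0 else 0)
        + (\<Sum>p\<in>UNIV. \<Sum>q\<in>UNIV. aggregated_quantity ks p q * h p q)"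
      by (simp add: sum.distrib)
    moreover have "(\<Sum>q\<in>UNIV. if p = source k then if q = sink k then max_qty k * h p q else 0 else 0)
        = (if p = source k then max_qty k * h p (sink k) else 0)" for p
      by simp
    ultimately show ?case using Cons.IH by simp
  qed (simp add: aggregated_quantity_def pair_bids_def)
  finally show ?thesis .
qed

text \<open>An explicit signed transport plan between the areas is split into positive and negative
  parts, one for each direction of trade.\<close>

lemma zero_sum_transport:
  fixes v :: "real ^ ('b1::finite + 'b2::finite)"
  assumes "(\<Sum>b\<in>UNIV. v $ b) = 0"
  obtains y where "\<And>p q. 0 \<le> y p q" "\<And>p q. isl p = isl q \<Longrightarrow> y p q = 0"
    "\<And>b. (\<Sum>q\<in>UNIV. y b q) - (\<Sum>p\<in>UNIV. y p b) = v $ b"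
proof -
  define m n where "m = real CARD('b1)" and "n = real CARD('b2)"
  have mn: "m > 0" "n > 0" by (simp_all add: m_def n_def)
  define V1 V2 where "V1 = (\<Sum>p\<in>UNIV. v $ Inl p)" and "V2 = (\<Sum>q\<in>UNIV. v $ Inr q)"
  have V: "V1 = - V2"
    using assms by (simp add: V1_def V2_def sum.Plus flip: UNIV_Plus_UNIV)
  \<comment> \<open>Each entry is spread evenly over the buses of the other area. The constant term
    repairs the row sums, and also the column sums because \<open>V1 = - V2\<close>.\<close>
  define z where "z p q = v $ Inl p / n - v $ Inr q / m + V2 / (m * n)" for p q
  have z1: "(\<Sum>q\<in>UNIV. z p q) = v $ Inl p" for p
    using mn by (simp add: z_def sum.distrib sum_subtractf V2_def[symmetric] flip: n_def sum_divide_distrib)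
  have z2: "(\<Sum>p\<in>UNIV. z p q) = - v $ Inr q" for q
    using mn V by (simp add: z_def sum.distrib sum_subtractf V1_def[symmetric] flip: m_def sum_divide_distrib)
  define y where "y p q = (case (p, q) of (Inl a, Inr b) \<Rightarrow> max 0 (z a b) | (Inr b, Inl a) \<Rightarrow> max 0 (- z a b) | _ \<Rightarrow> 0)" for p q
  have s: "(\<Sum>q\<in>UNIV. f q) = (\<Sum>a\<in>UNIV. f (Inl a)) + (\<Sum>b\<in>UNIV. f (Inr b))" for f :: "'b1 + 'b2 \<Rightarrow> real"
    by (simp add: sum.Plus flip: UNIV_Plus_UNIV)
  have m: "max 0 x - max 0 (- x) = x" for x :: real by simp
  show thesis
  proof
    show "0 \<le> y p q" for p q by (simp add: y_def split: sum.splits)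
    show "y p q = 0" if "isl p = isl q" for p q using that by (cases p; cases q) (auto simp: y_def)
    show "(\<Sum>q\<in>UNIV. y b q) - (\<Sum>p\<in>UNIV. y p b) = v $ b" for b
    proof (cases b)
      case (Inl a)
      then have "(\<Sum>q\<in>UNIV. y b q) - (\<Sum>p\<in>UNIV. y p b) = (\<Sum>q\<in>UNIV. max 0 (z a q) - max 0 (- z a q))"
        by (simp only: s sum_subtractf) (simp add: y_def)
      then show ?thesis unfolding m z1 using Inl by simp
    next
      case (Inr c)
      then have "(\<Sum>q\<in>UNIV. y b q) - (\<Sum>p\<in>UNIV. y p b) = - (\<Sum>p\<in>UNIV. max 0 (z p c) - max 0 (- z p c))"
        by (simp only: s sum_subtractf) (simp add: y_def)
      then show ?thesis unfolding m z2 using Inr by simp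
    qed
  qed
qed

text \<open>The bids of a pair share the amount \<open>y p q\<close> in proportion to their maximum
  quantities, so the pair as a whole clears exactly \<open>y p q\<close>.\<close>

lemma pro_rata_clearing:
  fixes bids :: "('b1::finite, 'b2::finite) bid list"
  assumes y: "\<And>p q. isl p = isl q \<Longrightarrow> y p q = 0"
      "\<And>b. (\<Sum>q\<in>UNIV. y b q) - (\<Sum>p\<in>UNIV. y p b) = v $ b"
    and bids: "\<And>k. k \<in> set bids \<Longrightarrow> isl (source k) \<noteq> isl (sink k)"
    and Q: "\<And>p q. isl p \<noteq> isl q \<Longrightarrow> 0 < aggregated_quantity bids p q"
  shows "(\<Sum>k<length bids. (max_qty (bids ! k) * (y (source (bids ! k)) (sink (bids ! k))
            / aggregated_quantity bids (source (bids ! k)) (sink (bids ! k)))) *\<^sub>R bid_vector (bids ! k)) = v"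
proof -
  have "(\<Sum>k<length bids. max_qty (bids ! k) * (y (source (bids ! k)) (sink (bids ! k))
            / aggregated_quantity bids (source (bids ! k)) (sink (bids ! k))) * incidence (bids ! k) b) = v $ b" for b
  proof -
    define h where "h p q = y p q / aggregated_quantity bids p q * (of_bool (p = b) - of_bool (q = b))" for p q
    have inc: "incidence k b = of_bool (source k = b) - of_bool (sink k = b)" if "k \<in> set bids" for k
      using bids[OF that] by (auto simp: incidence_def)
    have "(\<Sum>k<length bids. max_qty (bids ! k) * (y (source (bids ! k)) (sink (bids ! k))
            / aggregated_quantity bids (source (bids ! k)) (sink (bids ! k))) * incidence (bids ! k) b)
      = (\<Sum>k<length bids. max_qty (bids ! k) * h (source (bids ! k)) (sink (bids ! k)))"
      by (intro sum.cong) (auto simp: inc h_def)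
    also have "\<dots> = (\<Sum>p\<in>UNIV. \<Sum>q\<in>UNIV. y p q * (of_bool (p = b) - of_bool (q = b)))"
      unfolding sum_bids_by_pair
    proof (intro sum.cong refl)
      fix p q
      show "aggregated_quantity bids p q * h p q
          = y p q * (of_bool (p = b) - of_bool (q = b))"
        using y(1)[of p q] Q[of p q] by (cases "isl p = isl q") (auto simp: h_def)
    qed
    also have "\<dots> = (\<Sum>p\<in>UNIV. \<Sum>q\<in>UNIV. y p q * of_bool (p = b)) - (\<Sum>p\<in>UNIV. \<Sum>q\<in>UNIV. y p q * of_bool (q = b))"
      by (simp only: right_diff_distrib sum_subtractf)
    also have "\<dots> = (\<Sum>q\<in>UNIV. y b q) - (\<Sum>p\<in>UNIV. y p b)"
      by (subst (1) sum.swap) simp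
    finally show ?thesis using y(2) by simp
  qed
  then show ?thesis by (simp add: vec_eq_iff bid_vector_def)
qed

section \<open>Compactness and convergence\<close>

text \<open>Outside a ball around \<open>x\<close>, the minimum of \<open>f\<close> over
  \<open>P\<close> is attained and exceeds \<open>f x\<close>; points with values below it must lie
  in the ball.\<close>

lemma compact_unique_min_tendsto:
  fixes f :: "'a::metric_space \<Rightarrow> real"
  assumes P: "compact P" "continuous_on P f" and x: "x \<in> P"
    and unique: "\<And>y. \<lbrakk>y \<in> P; y \<noteq> x\<rbrakk> \<Longrightarrow> f x < f y"
    and X: "\<forall>\<^sub>F n in F. X n \<in> P" and lim: "\<And>\<epsilon>. \<epsilon> > 0 \<Longrightarrow> \<forall>\<^sub>F n in F. f (X n) < f x + \<epsilon>"
  shows "(X \<longlongrightarrow> x) F"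
proof (rule tendstoI)
  fix e :: real assume "e > 0"
  let ?K = "P - ball x e"
  show "\<forall>\<^sub>F n in F. dist (X n) x < e"
  proof (cases "?K = {}")
    case True
    then show ?thesis using X by (elim eventually_mono) (auto simp: dist_commute)
  next
    case False
    have "compact ?K" using P(1) by (simp add: compact_diff)
    then obtain z where z: "z \<in> ?K" "\<And>y. y \<in> ?K \<Longrightarrow> f z \<le> f y"
      using continuous_attains_inf[OF _ False continuous_on_subset[OF P(2)]] by blast
    have "f x < f z" by (rule unique) (use z(1) \<open>e > 0\<close> in auto)
    then have "\<forall>\<^sub>F n in F. f (X n) < f x + (f z - f x)" by (intro lim) simp
    with X show ?thesis
    proof eventually_elim
      case (elim n)
      then have "X n \<notin> ?K" using z(2)[of "X n"] by auto
      then show ?case using elim(1) by (simp add: dist_commute)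
    qed
  qed
qed

section \<open>Phase angles as coordinates for feasible schedules\<close>

definition angle_vec where
  "angle_vec x = (\<chi> v. bus_angle x v)"

text \<open>Power balance at the internal buses forces the generations. The zero-injection equations
  at the boundary buses remain conditions on \<open>\<theta>\<close>.\<close>

definition dispatch_of where
  "dispatch_of net \<theta> =
     \<lparr>gen1 = restrict_vec int1 (nodal_matrix net *v \<theta>) + load1 net,
      gen2 = restrict_vec int2 (nodal_matrix net *v \<theta>) + load2 net,
      ang1 = restrict_vec int1 \<theta>, ang2 = restrict_vec int2 \<theta>,
      bang1 = restrict_vec bnd1 \<theta>, bang2 = restrict_vec bnd2 \<theta>\<rparr>"

lemma dispatch_of_simps [simp]:
  "gen1 (dispatch_of net \<theta>) = restrict_vec int1 (nodal_matrix net *v \<theta>) + load1 net"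
  "gen2 (dispatch_of net \<theta>) = restrict_vec int2 (nodal_matrix net *v \<theta>) + load2 net"
  "ang1 (dispatch_of net \<theta>) = restrict_vec int1 \<theta>" "ang2 (dispatch_of net \<theta>) = restrict_vec int2 \<theta>"
  "bang1 (dispatch_of net \<theta>) = restrict_vec bnd1 \<theta>" "bang2 (dispatch_of net \<theta>) = restrict_vec bnd2 \<theta>"
  by (simp_all add: dispatch_of_def)

lemma restrict_angle_vec [simp]:
  "restrict_vec int1 (angle_vec x) = ang1 x" "restrict_vec int2 (angle_vec x) = ang2 x"
  "restrict_vec bnd1 (angle_vec x) = bang1 x" "restrict_vec bnd2 (angle_vec x) = bang2 x"
  by (simp_all add: vec_eq_iff angle_vec_def)

lemma bus_angle_dispatch_of [simp]: "bus_angle (dispatch_of net \<theta>) v = \<theta> $ v"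
  by (cases "(dispatch_of net \<theta>, v)" rule: bus_angle.cases) simp_all

lemma dispatch_of_angle_vec:
  assumes "dc_network net" "jed_feasible net x"
  shows "dispatch_of net (angle_vec x) = x"
  using assms(2) unfolding dispatch_of_def restrict_nodal_matrix[OF assms(1)]
  by (cases x) (simp add: jed_feasible_def power_flow_def Let_def add.commute)

abbreviation ref_node where
  "ref_node net \<equiv> (case ref_bus net of Inl b \<Rightarrow> bnd1 b | Inr b \<Rightarrow> bnd2 b)"

lemma jed_feasible_dispatch_of:
  assumes "dc_network net"
  shows "jed_feasible net (dispatch_of net \<theta>) \<longleftrightarrow>
    gen_limits net (dispatch_of net \<theta>) \<and> line_limits net (dispatch_of net \<theta>) \<and>
    restrict_vec bnd1 (nodal_matrix net *v \<theta>) = 0 \<and> restrict_vec bnd2 (nodal_matrix net *v \<theta>) = 0 \<and>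
    \<theta> $ ref_node net = 0"
  by (auto simp: jed_feasible_def power_flow_def angle_reference_def Let_def
      restrict_nodal_matrix[OF assms] add.commute split: sum.splits)

lemma closed_Collect_vec_le:
  fixes f g :: "'a::topological_space \<Rightarrow> real ^ 'n"
  assumes "continuous_on UNIV f" "continuous_on UNIV g"
  shows "closed {x. f x \<le> g x}"
  unfolding less_eq_vec_def
  by (intro closed_Collect_all closed_Collect_le continuous_intros assms)

lemma continuous_on_matrix_vector_mult [continuous_intros]:
  fixes A :: "real ^ 'n ^ 'm"
  shows "continuous_on S f \<Longrightarrow> continuous_on S (\<lambda>x. A *v f x)"
  by (rule continuous_on_compose2[OF matrix_vector_mult_linear_continuous_on]) auto

text \<open>Generation limits confine the nodal injections to a box, and injections together with
  the reference angle determine the angles linearly and injectively.\<close>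

lemma compact_feasible_angles:
  fixes net :: "('i1::finite, 'b1::finite, 'i2::finite, 'b2::finite, 'l::finite, 'm1::finite, 'm2::finite, 'mt::finite) network"
  assumes net: "dc_network net"
  shows "compact {\<theta>. jed_feasible net (dispatch_of net \<theta>)}" (is "compact ?P")
proof -
  let ?Y = "nodal_matrix net" and ?r = "ref_node net"
  have "closed ?P"
    unfolding jed_feasible_dispatch_of[OF net] gen_limits_def line_limits_def
    by simp (intro closed_Collect_conj closed_Collect_vec_le closed_Collect_eq continuous_intros)
  moreover have "bounded ?P"
  proof -
    define T where "T \<theta> = (?Y *v \<theta>, \<theta> $ ?r)" for \<theta>
    have "linear T"
      by (rule linearI) (simp_all add: T_def matrix_vector_right_distrib matrix_vector_mult_scaleR)
    moreover have "inj T"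
      unfolding linear_injective_0[OF \<open>linear T\<close>]
      by (auto simp: T_def zero_prod_def intro: zero_energy_zero[OF net, where v = ?r])
    ultimately obtain B where B: "B > 0" "\<And>\<theta>. B * norm \<theta> \<le> norm (T \<theta>)"
      using linear_inj_bounded_below_pos by blast
    \<comment> \<open>Bounds on injections, not angles: the angle fields only lay out generation
      limits minus loads by bus, with 0 at boundary buses.\<close>
    let ?lo = "angle_vec \<lparr>gen1 = 0, gen2 = 0, ang1 = gen_min1 net - load1 net, ang2 = gen_min2 net - load2 net,
      bang1 = 0, bang2 = 0\<rparr> :: real ^ ('i1, 'b1, 'i2, 'b2) bus"
    let ?hi = "angle_vec \<lparr>gen1 = 0, gen2 = 0, ang1 = gen_max1 net - load1 net, ang2 = gen_max2 net - load2 net,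
      bang1 = 0, bang2 = 0\<rparr> :: real ^ ('i1, 'b1, 'i2, 'b2) bus"
    obtain R where R: "\<And>x. x \<in> cbox ?lo ?hi \<Longrightarrow> norm x \<le> R"
      using bounded_cbox unfolding bounded_iff by blast
    have "norm \<theta> \<le> R / B" if "\<theta> \<in> ?P" for \<theta>
    proof -
      have f: "gen_limits net (dispatch_of net \<theta>)" "restrict_vec bnd1 (?Y *v \<theta>) = 0" "restrict_vec bnd2 (?Y *v \<theta>) = 0"
        "\<theta> $ ?r = 0"
        using that unfolding mem_Collect_eq jed_feasible_dispatch_of[OF net] by blast+
      have "?lo $ v \<le> (?Y *v \<theta>) $ v \<and> (?Y *v \<theta>) $ v \<le> ?hi $ v" for v
        using f(1-3) by (cases "(dispatch_of net \<theta>, v)" rule: bus_angle.cases)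
          (auto simp: angle_vec_def gen_limits_def less_eq_vec_def vec_eq_iff algebra_simps)
      then have "?Y *v \<theta> \<in> cbox ?lo ?hi" by (simp only: mem_box_cart) blast
      then have "norm (?Y *v \<theta>) \<le> R" by (rule R)
      then have "B * norm \<theta> \<le> R" using B(2)[of \<theta>] f(4) by (simp add: T_def norm_Pair)
      then show ?thesis using B(1) by (simp add: field_simps)
    qed
    then show ?thesis by (auto simp: bounded_iff)
  qed
  ultimately show ?thesis by (simp add: compact_eq_bounded_closed)
qed

lemma is_arg_min_arg_min:
  assumes "\<exists>!x. is_arg_min f P x"
  shows "is_arg_min f P (arg_min f P)"
  unfolding arg_min_def using assms by (metis (mono_tags) someI_ex)

lemma continuous_interface:
  "continuous_on S (\<lambda>\<theta>. interface net (restrict_vec bnd1 \<theta>) (restrict_vec bnd2 \<theta>))"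
proof -
  have "continuous_on S (\<lambda>\<theta>. case b of Inl p \<Rightarrow> interface1 net (restrict_vec bnd1 \<theta>) (restrict_vec bnd2 \<theta>) $ p
      | Inr q \<Rightarrow> interface2 net (restrict_vec bnd1 \<theta>) (restrict_vec bnd2 \<theta>) $ q)" for b
    by (cases b) (simp_all add: interface1_def interface2_def continuous_intros)
  then show ?thesis unfolding interface_def by (intro continuous_intros)
qed

theorem theorem1:
  fixes net :: "('i1::finite, 'b1::finite, 'i2::finite, 'b2::finite, 'l::finite,
                 'm1::finite, 'm2::finite, 'mt::finite) network"
    and bids :: "nat \<Rightarrow> ('b1, 'b2) bid list"
  assumes net: "dc_network net"
    and convex1: "convex_on UNIV (cost1 net)"
    and convex2: "convex_on UNIV (cost2 net)"
    and bids: "\<And>N k. k \<in> set (bids N) \<Longrightarrow> valid_bid N k"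
    and jed_feasible: "\<exists>x. jed_feasible net x"
    and jed_unique: "\<exists>!x. is_arg_min (jed_cost net) (jed_feasible net) x"
    and gcts_feasible: "\<forall>\<^sub>F N in sequentially. \<exists>z. gcts_feasible net (bids N) z"
    and gcts_unique: "\<forall>\<^sub>F N in sequentially.
           \<exists>!z. is_arg_min (gcts_cost net (bids N)) (gcts_feasible net (bids N)) z"
    and unbounded: "\<And>p q. isl p \<noteq> isl q \<Longrightarrow>
           filterlim (\<lambda>N. aggregated_quantity (bids N) p q) at_top sequentially"
    and prices: "\<And>\<epsilon>. \<epsilon> > 0 \<Longrightarrow> \<forall>\<^sub>F N in sequentially. \<forall>k \<in> set (bids N). \<bar>price k\<bar> < \<epsilon>"
  shows "(\<forall>l \<in> tie_lines net.
            (\<lambda>N. line_flow net (gcts_schedule net (bids N)) l)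
              \<longlonglongrightarrow> line_flow net (jed_schedule net) l) \<and>
         (\<lambda>N. gen1 (gcts_schedule net (bids N))) \<longlonglongrightarrow> gen1 (jed_schedule net) \<and>
         (\<lambda>N. gen2 (gcts_schedule net (bids N))) \<longlonglongrightarrow> gen2 (jed_schedule net)"
proof -
  define D where "D = dispatch_of net"
  define P where "P = {\<theta>. jed_feasible net (D \<theta>)}"
  define J where "J = (\<lambda>\<theta>. jed_cost net (D \<theta>))"
  define v where "v x = interface net (bang1 x) (bang2 x)" for x :: "('i1, 'b1, 'i2, 'b2) dispatch"
  define x where "x N = gcts_schedule net (bids N)" for N
  define s where "s N = snd (arg_min (gcts_cost net (bids N)) (gcts_feasible net (bids N)))" for N
  define opt where "opt = jed_schedule net"
  have D_angle: "D (angle_vec y) = y" if "jed_feasible net y" for y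
    using dispatch_of_angle_vec[OF net that] by (simp add: D_def)
  have P_compact: "compact P" using compact_feasible_angles[OF net] by (simp add: P_def D_def)
  have angle_P: "angle_vec y \<in> P" if "jed_feasible net y" for y
    using that D_angle by (simp add: P_def)

  have opt: "is_arg_min (jed_cost net) (jed_feasible net) opt"
    unfolding opt_def jed_schedule_def by (rule is_arg_min_arg_min[OF jed_unique])
  then have opt_feas: "jed_feasible net opt" by (simp add: is_arg_min_def)
  \<comment> \<open>\<open>arg_min\<close> is known to be an optimum only for large
    \<open>N\<close>, so all facts about \<open>x N\<close> are eventual.\<close>
  have gcts_opt: "\<forall>\<^sub>F N in sequentially.
      is_arg_min (gcts_cost net (bids N)) (gcts_feasible net (bids N)) (x N, s N)"
    using gcts_unique
    by (elim eventually_mono) (simp add: x_def s_def gcts_schedule_def is_arg_min_arg_min)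
  then have x_feas: "\<forall>\<^sub>F N in sequentially. jed_feasible net (x N)"
    by (elim eventually_mono) (simp add: is_arg_min_def gcts_feasible_iff)

  \<comment> \<open>Interface injections are continuous in the angles, so compactness bounds them
    uniformly in \<open>N\<close>.\<close>
  obtain R where R: "\<And>y. jed_feasible net y \<Longrightarrow> norm (v opt - v y) \<le> R"
  proof -
    have "compact ((\<lambda>\<theta>. interface net (restrict_vec bnd1 \<theta>) (restrict_vec bnd2 \<theta>)) ` P)"
      by (intro compact_continuous_image continuous_interface P_compact)
    from compact_imp_bounded[OF this]
    obtain R where R: "\<And>\<theta>. \<theta> \<in> P \<Longrightarrow> norm (interface net (restrict_vec bnd1 \<theta>) (restrict_vec bnd2 \<theta>)) \<le> R"
      by (auto simp: bounded_iff)
    have le: "norm (v y) \<le> R" if "jed_feasible net y" for y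
      using R[OF angle_P[OF that]] by (simp add: v_def)
    show thesis
    proof (rule that[of "R + R"])
      show "norm (v opt - v y) \<le> R + R" if "jed_feasible net y" for y
        using norm_triangle_ineq4[of "v opt" "v y"] le[OF that] le[OF opt_feas] by linarith
    qed
  qed
  have "(\<Sum>b\<in>UNIV. v opt $ b) = 0"
    using interface_sum_zero[OF net, of "bang1 opt" "bang2 opt"]
    by (simp add: v_def interface_def sum.Plus flip: UNIV_Plus_UNIV)
  then obtain y where y: "\<And>p q. 0 \<le> y p q" "\<And>p q. isl p = isl q \<Longrightarrow> y p q = 0"
    "\<And>b. (\<Sum>q\<in>UNIV. y b q) - (\<Sum>p\<in>UNIV. y p b) = v opt $ b"
    using zero_sum_transport[of "v opt"] by metis
  have ample: "\<forall>\<^sub>F N in sequentially. \<forall>p q. isl p \<noteq> isl q \<longrightarrow>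
      0 < aggregated_quantity (bids N) p q \<and> y p q \<le> aggregated_quantity (bids N) p q"
  proof (intro eventually_all_finite)
    fix p q
    show "\<forall>\<^sub>F N in sequentially. isl p \<noteq> isl q \<longrightarrow>
      0 < aggregated_quantity (bids N) p q \<and> y p q \<le> aggregated_quantity (bids N) p q"
    proof (cases "isl p = isl q")
      case False
      \<comment> \<open>The 1 secures a positive divisor for the pro rata shares even when
        \<open>y p q = 0\<close>.\<close>
      then have "\<forall>\<^sub>F N in sequentially. max 1 (y p q) \<le> aggregated_quantity (bids N) p q"
        using unbounded unfolding filterlim_at_top by blast
      then show ?thesis by (elim eventually_mono) auto
    qed simp
  qed

  obtain C where C: "C \<ge> 0" and near: "\<And>(K :: nat set) c s t. \<lbrakk>finite K; c ` K \<subseteq> range bid_vector\<rbrakk> \<Longrightarrow>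
       \<exists>r. (\<forall>k\<in>K. min (s k) (t k) \<le> r k \<and> r k \<le> max (s k) (t k)) \<and>
           (\<Sum>k\<in>K. r k *\<^sub>R c k) = (\<Sum>k\<in>K. t k *\<^sub>R c k :: real ^ ('b1 + 'b2)) \<and>
           (\<Sum>k\<in>K. \<bar>r k - s k\<bar>) \<le> C * norm ((\<Sum>k\<in>K. t k *\<^sub>R c k) - (\<Sum>k\<in>K. s k *\<^sub>R c k))"
    by (rule box_solution_near[OF finite_range_bid_vector, where 'k = nat]) (rule that)

  have cost_lim: "\<forall>\<^sub>F N in sequentially. jed_cost net (x N) < jed_cost net opt + \<epsilon>" if "\<epsilon> > 0" for \<epsilon>
  proof -
    have R0: "R \<ge> 0" using R[OF opt_feas] by simp
    \<comment> \<open>The added 1 keeps the divisor positive and the resulting bound strict.\<close>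
    define \<delta> where "\<delta> = \<epsilon> / (C * R + 1)"
    have CR: "C * R + 1 > 0" using C R0 by (simp add: add_nonneg_pos)
    then have \<delta>: "\<delta> > 0" "\<delta> * (C * R) < \<epsilon>"
      using \<open>\<epsilon> > 0\<close> by (auto simp: \<delta>_def field_simps)
    from gcts_opt ample prices[OF \<delta>(1)] show ?thesis
    proof eventually_elim
      case (elim N)
      define n where "n = length (bids N)"
      define b where "b k = bids N ! k" for k
      have b_in: "b k \<in> set (bids N)" if "k < n" for k using that by (simp add: b_def n_def)
      have opp: "isl (source k) \<noteq> isl (sink k)" if "k \<in> set (bids N)" for k
        using bids[OF that] by (simp add: valid_bid_def)
      have feas: "jed_feasible net (x N)" "length (s N) = n"
          "\<And>k. k < n \<Longrightarrow> 0 \<le> s N ! k \<and> s N ! k \<le> max_qty (b k)"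
          "(\<Sum>k<n. s N ! k *\<^sub>R bid_vector (b k)) = v (x N)"
        using elim(1) by (auto simp: is_arg_min_def gcts_feasible_iff n_def b_def v_def)
      define t where "t k = max_qty (b k) * (y (source (b k)) (sink (b k))
            / aggregated_quantity (bids N) (source (b k)) (sink (b k)))" for k
      have t_box: "0 \<le> t k" "t k \<le> max_qty (b k)" if "k < n" for k
      proof -
        have "0 \<le> max_qty (b k)" using feas(3)[OF that] by linarith
        moreover have "0 < aggregated_quantity (bids N) (source (b k)) (sink (b k))"
            "y (source (b k)) (sink (b k)) \<le> aggregated_quantity (bids N) (source (b k)) (sink (b k))"
          using elim(2) opp[OF b_in[OF that]] by auto
        ultimately show "0 \<le> t k" "t k \<le> max_qty (b k)"
          using y(1) unfolding t_def by (auto simp del: times_divide_eq_right intro!: mult_left_le)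
      qed
      have t_sum: "(\<Sum>k<n. t k *\<^sub>R bid_vector (b k)) = v opt"
        unfolding t_def n_def b_def
        by (rule pro_rata_clearing) (use y elim(2) opp in auto)
      \<comment> \<open>Lying between \<open>s N\<close> and \<open>t\<close>, both within the bid
        limits, \<open>r\<close> respects those limits as well, so \<open>opt\<close> with
        \<open>r\<close> competes against the GCTS optimum.\<close>
      obtain r where r: "\<forall>k\<in>{..<n}. min (s N ! k) (t k) \<le> r k \<and> r k \<le> max (s N ! k) (t k)"
          "(\<Sum>k<n. r k *\<^sub>R bid_vector (b k)) = v opt"
          "(\<Sum>k<n. \<bar>r k - s N ! k\<bar>) \<le> C * norm (v opt - v (x N))"
        using near[of "{..<n}" "\<lambda>k. bid_vector (b k)" "\<lambda>k. s N ! k" t] t_sum feas(4) by auto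
      have "gcts_feasible net (bids N) (opt, map r [0..<n])"
        using opt_feas r(2) r(1) t_box feas(3)
        by (auto simp: gcts_feasible_iff v_def min_def max_def split: if_splits simp flip: n_def b_def) 
          (meson order_trans lessThan_iff)+
      then have "gcts_cost net (bids N) (x N, s N) \<le> gcts_cost net (bids N) (opt, map r [0..<n])"
        using elim(1) by (auto simp: is_arg_min_linorder)
      \<comment> \<open>Only the differences \<open>r k - s N ! k\<close> are priced; the total
        cleared quantity, which may be large, never enters.\<close>
      then have "jed_cost net (x N) \<le> jed_cost net opt + (\<Sum>k<n. price (b k) * r k - price (b k) * s N ! k)"
        by (simp add: gcts_cost_def jed_cost_def sum_subtractf flip: n_def b_def)
      also have "(\<Sum>k<n. price (b k) * r k - price (b k) * s N ! k) \<le> (\<Sum>k<n. \<delta> * \<bar>r k - s N ! k\<bar>)"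
      proof (rule sum_mono)
        fix k assume "k \<in> {..<n}"
        then have "\<bar>price (b k)\<bar> \<le> \<delta>" using elim(3) b_in by (simp add: less_imp_le)
        then have "\<bar>price (b k) * (r k - s N ! k)\<bar> \<le> \<delta> * \<bar>r k - s N ! k\<bar>"
          unfolding abs_mult by (intro mult_right_mono) auto
        then show "price (b k) * r k - price (b k) * s N ! k \<le> \<delta> * \<bar>r k - s N ! k\<bar>"
          by (simp add: right_diff_distrib)
      qed
      also have "(\<Sum>k<n. \<delta> * \<bar>r k - s N ! k\<bar>) \<le> \<delta> * (C * R)"
        unfolding sum_distrib_left[symmetric] using \<delta>(1) C R[OF feas(1)] r(3)
        by (intro mult_left_mono) (auto intro: order_trans mult_left_mono)
      also note \<delta>(2)
      finally show ?case by simp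
    qed
  qed

  \<comment> \<open>Real-valued convex costs on the whole space are continuous.\<close>
  have J_cont: "continuous_on P J"
  proof -
    note cont = convex_on_continuous[OF open_UNIV convex1] convex_on_continuous[OF open_UNIV convex2]
    show ?thesis unfolding J_def jed_cost_def D_def dispatch_of_simps
      by (intro continuous_intros continuous_on_compose2[OF cont(1)] continuous_on_compose2[OF cont(2)]) auto
  qed
  have lim: "(\<lambda>N. angle_vec (x N)) \<longlonglongrightarrow> angle_vec opt"
  proof (rule compact_unique_min_tendsto[OF P_compact J_cont angle_P[OF opt_feas]])
    \<comment> \<open>Otherwise \<open>D \<phi>\<close> would also be optimal, hence equal to
      \<open>opt\<close>; a dispatch carries its angles, so \<open>\<phi>\<close> would be
      \<open>angle_vec opt\<close>.\<close>
    show "J (angle_vec opt) < J \<phi>" if "\<phi> \<in> P" "\<phi> \<noteq> angle_vec opt" for \<phi>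
    proof (rule ccontr)
      assume "\<not> J (angle_vec opt) < J \<phi>"
      then have "is_arg_min (jed_cost net) (jed_feasible net) (D \<phi>)"
        using opt that(1) D_angle[OF opt_feas] by (force simp: is_arg_min_linorder P_def J_def)
      then have "D \<phi> = opt" using opt jed_unique by blast
      then have "\<phi> = angle_vec opt" by (auto simp: vec_eq_iff angle_vec_def D_def)
      with that(2) show False by simp
    qed
    show "\<forall>\<^sub>F N in sequentially. angle_vec (x N) \<in> P"
      using x_feas by (elim eventually_mono) (rule angle_P)
    show "\<forall>\<^sub>F N in sequentially. J (angle_vec (x N)) < J (angle_vec opt) + \<epsilon>" if "\<epsilon> > 0" for \<epsilon>
      using x_feas cost_lim[OF that]
      by eventually_elim (simp add: J_def D_angle opt_feas)
  qed

  \<comment> \<open>Any quantity continuous in the angles inherits the convergence, since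
    \<open>x N\<close> is eventually recovered from its angles.\<close>
  have transfer: "(\<lambda>N. g (x N)) \<longlonglongrightarrow> g opt"
    if "continuous_on UNIV (\<lambda>\<theta>. g (D \<theta>))" for g :: "_ \<Rightarrow> 'z::topological_space"
  proof -
    have "(\<lambda>N. g (D (angle_vec (x N)))) \<longlonglongrightarrow> g (D (angle_vec opt))"
      using that lim by (rule continuous_on_tendsto_compose) auto
    moreover have "\<forall>\<^sub>F N in sequentially. g (D (angle_vec (x N))) = g (x N)"
      using x_feas by (elim eventually_mono) (simp add: D_angle)
    ultimately show ?thesis
      using D_angle[OF opt_feas] by (auto dest: Lim_transform_eventually)
  qed
  show ?thesis
    unfolding x_def[symmetric] opt_def[symmetric]
  proof (intro conjI ballI)
    show "(\<lambda>N. line_flow net (x N) l) \<longlonglongrightarrow> line_flow net opt l" for l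
      by (rule transfer) (simp add: line_flow_def D_def divide_inverse continuous_intros)
    show "(\<lambda>N. gen1 (x N)) \<longlonglongrightarrow> gen1 opt"
      by (rule transfer) (simp add: D_def continuous_intros)
    show "(\<lambda>N. gen2 (x N)) \<longlonglongrightarrow> gen2 opt"
      by (rule transfer) (simp add: D_def continuous_intros)
  qed
qed

end
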